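(* Let $p\ge1$, $r\ge1$, $n\ge1$ be integers, let $a,b\in\mathbb{R}^n$ with $y=\sum_{i=1}^n a_ib_i\ne0$, and let $\widehat{y}$ be the result of computing the inner product $y$ with limited-precision stochastic rounding $\mathrm{SR}_{p,r}$: $\widehat{t}_k=\mathrm{SR}_{p,r}(a_kb_k)$ for $k=1,\ldots,n$, $\widehat{s}_1=\widehat{t}_1$, $\widehat{s}_k=\mathrm{SR}_{p,r}(\widehat{s}_{k-1}+\widehat{t}_k)$ for $k=2,\ldots,n$, and $\widehat{y}=\widehat{s}_n$. Then, for any $0<\lambda<1$, $$\frac{|\widehat{y}-y|}{|y|}\le \kappa(a\circ b)\left(\sqrt{\gamma_{n}(u_p^2)/\lambda}+\gamma_{n}(u_p+u_{p+r})-\gamma_{n}(u_p)\right)$$ with probability at least $1-\lambda$.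
   Context: Notation: $u_q=2^{1-q}$ for an integer $q\ge1$; $\gamma_m(u)=(1+u)^m-1$; $a\circ b=(a_1b_1,\ldots,a_nb_n)$ is the Hadamard product and $\kappa(a\circ b)=\dfrac{\sum_{i=1}^n|a_ib_i|}{\left|\sum_{i=1}^n a_ib_i\right|}$ is the condition number of the inner product. Floating-point numbers: $\mathcal{F}$ is the precision-$p$ binary floating-point system, i.e. the set of $0$ and all real numbers $(-1)^s 2^e m$ with $s\in\{0,1\}$, $e$ an integer exponent, and $m\in[1,2)$ having at most $p$ significant bits. Standard model: no underflow or overflow occurs (the exponent range may be regarded as unlimited). For $x\in\mathbb{R}$, $\lceil x\rceil_p=\min\{y\in\mathcal{F}:y\ge x\}$ and $\lfloor x\rfloor_p=\max\{y\in\mathcal{F}:y\le x\}$. For $x\neq0$ written uniquely as $x=(-1)^s2^em$ with $m\in[1,2)$ real, $\mathrm{ulp}_p(x)=2^{e-p+1}$, and $\mathrm{fl}_{p+r}(x)$ is $x$ with the binary expansion of its significand $m$ truncated to the first $p+r$ significant bits; $\mathrm{fl}_{p+r}(0)=0$. Limited-precision stochastic rounding with $r$ random bits: $\mathrm{SR}_{p,r}(0)=0$, and for $x\ne0$, $\mathrm{SR}_{p,r}(x)$ is the random variable equal to $\lceil x\rceil_p$ with probability $q_r(x)$ and to $\lfloor x\rfloor_p$ with probability $1-q_r(x)$, where $q_r(x)=(\mathrm{fl}_{p+r}(x)-\lfloor x\rfloor_p)/\mathrm{ulp}_p(x)$. In an algorithm, the inputs are deterministic and each rounding, conditionally on all previous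 roundings, has this two-point distribution with $x$ the exact result of the current operation. *)

theory Defs
  imports "HOL-Probability.Probability"
begin

definition unit_roundoff :: "nat \<Rightarrow> real" where
  "unit_roundoff q = 2 powi (1 - int q)"

definition gam :: "nat \<Rightarrow> real \<Rightarrow> real" where
  "gam m u = (1 + u) ^ m - 1"

text \<open>Vectors of length \<open>n\<close> are functions on \<open>nat\<close>, of which only the values at \<open>1, \<dots>, n\<close> are used.\<close>

definition hadamard :: "(nat \<Rightarrow> real) \<Rightarrow> (nat \<Rightarrow> real) \<Rightarrow> nat \<Rightarrow> real" where
  "hadamard a b = (\<lambda>i. a i * b i)"

definition cond_num :: "nat \<Rightarrow> (nat \<Rightarrow> real) \<Rightarrow> real" where
  "cond_num n c = (\<Sum>i=1..n. \<bar>c i\<bar>) / \<bar>\<Sum>i=1..n. c i\<bar>"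

text \<open>For \<open>m \<in> [1,2)\<close>, having at most \<open>p\<close> significant bits means that \<open>m\<close> is an integer multiple
  of \<open>2 powi (1 - int p)\<close>. The exponent range is unlimited.\<close>

definition floats :: "nat \<Rightarrow> real set" where
  "floats p = insert 0 {(-1) ^ s * 2 powi e * m | (s::nat) (e::int) (m::real).
     s \<in> {0, 1} \<and> 1 \<le> m \<and> m < 2 \<and> m * 2 ^ (p - 1) \<in> \<int>}"

definition fp_ceil :: "nat \<Rightarrow> real \<Rightarrow> real" where
  "fp_ceil p x = (LEAST y. y \<in> floats p \<and> x \<le> y)"

definition fp_floor :: "nat \<Rightarrow> real \<Rightarrow> real" where
  "fp_floor p x = (GREATEST y. y \<in> floats p \<and> y \<le> x)"

definition fp_exponent :: "real \<Rightarrow> int" where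
  "fp_exponent x = \<lfloor>log 2 \<bar>x\<bar>\<rfloor>"

definition fp_significand :: "real \<Rightarrow> real" where
  "fp_significand x = \<bar>x\<bar> / 2 powi fp_exponent x"

text \<open>The two preceding functions give the unique decomposition of a nonzero real:\<close>

lemma fp_decomposition:
  assumes "x \<noteq> 0"
  shows "x = sgn x * 2 powi fp_exponent x * fp_significand x"
    and "1 \<le> fp_significand x" and "fp_significand x < 2"
proof -
  show "x = sgn x * 2 powi fp_exponent x * fp_significand x"
    by (simp add: fp_significand_def sgn_mult_abs)
  have pos: "0 < \<bar>x\<bar>" using assms by simp
  have *: "of_int (fp_exponent x) \<le> log 2 \<bar>x\<bar>" "log 2 \<bar>x\<bar> < of_int (fp_exponent x) + 1"
    unfolding fp_exponent_def by linarith+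
  have "2 powr of_int (fp_exponent x) \<le> \<bar>x\<bar>"
    using *(1) pos by (simp add: le_log_iff)
  then show "1 \<le> fp_significand x"
    by (simp add: fp_significand_def powr_real_of_int')
  have "\<bar>x\<bar> < 2 powr (of_int (fp_exponent x) + 1)"
    using *(2) pos by (simp add: log_less_iff)
  then show "fp_significand x < 2"
    by (simp add: fp_significand_def powr_add powr_real_of_int' divide_simps mult.commute)
qed

lemma fp_decomposition_unique:
  assumes "\<bar>x\<bar> = 2 powi e * m" and "1 \<le> m" and "m < 2"
  shows "e = fp_exponent x" and "m = fp_significand x"
proof -
  have "log 2 \<bar>x\<bar> = of_int e + log 2 m"
    using assms by (simp add: log_mult flip: powr_real_of_int')
  moreover have "0 \<le> log 2 m" "log 2 m < 1"
    using assms by simp_all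
  ultimately show e: "e = fp_exponent x"
    unfolding fp_exponent_def by linarith
  show "m = fp_significand x"
    using assms(1) by (simp add: fp_significand_def flip: e)
qed

definition ulp :: "nat \<Rightarrow> real \<Rightarrow> real" where
  "ulp p x = 2 powi (fp_exponent x - int p + 1)"

text \<open>Truncation of the binary expansion of the significand to its first \<open>q\<close> bits, one of which is
  the leading bit; this rounds towards zero for either sign of \<open>x\<close>.\<close>

definition fp_trunc :: "nat \<Rightarrow> real \<Rightarrow> real" where
  "fp_trunc q x = (if x = 0 then 0 else
     sgn x * 2 powi fp_exponent x * (of_int \<lfloor>fp_significand x * 2 ^ (q - 1)\<rfloor> / 2 ^ (q - 1)))"

definition sr_prob :: "nat \<Rightarrow> nat \<Rightarrow> real \<Rightarrow> real" where
  "sr_prob p r x = (fp_trunc (p + r) x - fp_floor p x) / ulp p x"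

definition SR :: "nat \<Rightarrow> nat \<Rightarrow> real \<Rightarrow> real pmf" where
  "SR p r x = (if x = 0 then return_pmf 0 else
     map_pmf (\<lambda>up. if up then fp_ceil p x else fp_floor p x) (bernoulli_pmf (sr_prob p r x)))"

text \<open>The joint law of the roundings is given by the monadic composition: each rounding is
  drawn, conditionally on the previous ones, from \<open>SR p r\<close> of the exact result of the current
  operation. \<open>sr_inner p r a b k\<close> is the law of the \<open>k\<close>-th computed partial sum;
  \<open>k = 0\<close> is a dummy case.\<close>

fun sr_inner :: "nat \<Rightarrow> nat \<Rightarrow> (nat \<Rightarrow> real) \<Rightarrow> (nat \<Rightarrow> real) \<Rightarrow> nat \<Rightarrow> real pmf" where
  "sr_inner p r a b 0 = return_pmf 0"
| "sr_inner p r a b (Suc 0) = SR p r (a 1 * b 1)"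
| "sr_inner p r a b (Suc (Suc k)) =
     bind_pmf (sr_inner p r a b (Suc k)) (\<lambda>s.
     bind_pmf (SR p r (a (Suc (Suc k)) * b (Suc (Suc k)))) (\<lambda>t.
     SR p r (s + t)))"

end

theory Submission imports Defs begin

text \<open>
  Write \<open>u = unit_roundoff p\<close>, \<open>v = unit_roundoff (p + r)\<close>, \<open>c\<^sub>i = a\<^sub>i b\<^sub>i\<close> and
  \<open>S = \<Sum>\<bar>c\<^sub>i\<bar>\<close>. Only four properties of the rounding matter: \<open>SR p r x\<close> has finite support, its
  mean is the truncation \<open>\<mu> x = fp_trunc (p + r) x\<close>, its values differ from \<open>\<mu> x\<close> by at most
  \<open>u \<bar>x\<bar>\<close>, and \<open>\<bar>\<mu> x - x\<bar> \<le> v \<bar>x\<bar>\<close>. Hence a rounding multiplies its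
  argument by \<open>1 + \<alpha> + \<beta>\<close>, where the noise \<open>\<alpha>\<close> has conditional mean zero and
  \<open>\<bar>\<alpha>\<bar> \<le> u\<close>, and the bias \<open>\<beta>\<close> is determined by the argument and satisfies
  \<open>\<bar>\<beta>\<bar> \<le> v\<close>.

  Run next to the computed partial sums \<open>s\<^sub>k\<close> the sums \<open>z\<^sub>k\<close> that the same noises produce without
  the bias: \<open>z\<^sub>1 = c\<^sub>1 (1 + \<alpha>)\<close> and, for \<open>k \<ge> 2\<close>,
  \<open>z\<^sub>k = (z\<^sub>k\<^sub>-\<^sub>1 + c\<^sub>k (1 + \<alpha>)) (1 + \<alpha>')\<close>. The error \<open>s\<^sub>n - y\<close> is split at \<open>z\<^sub>n\<close>.

  The part \<open>s\<^sub>n - z\<^sub>n\<close> is bounded on every outcome by \<open>S ((1 + u + v)\<^sup>n - (1 + u)\<^sup>n)\<close>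
  (\<open>coupled_bounds\<close>). The part \<open>z\<^sub>n - y\<close> has mean zero, because each noise has conditional mean
  zero, and its variance is at most \<open>S\<^sup>2 ((1 + u\<^sup>2)\<^sup>n - 1)\<close> (\<open>second_moment_martingale\<close>), because each
  factor \<open>1 + \<alpha>\<close> multiplies a conditional second moment by at most \<open>1 + u\<^sup>2\<close>. Chebyshev's
  inequality bounds it by \<open>S sqrt (gam n (u\<^sup>2) / lam)\<close> with probability at least \<open>1 - lam\<close>.
  Dividing by \<open>\<bar>y\<bar>\<close> turns \<open>S\<close> into the condition number.
\<close>

section \<open>Neighbouring floating-point numbers\<close>

text \<open>Beyond \<open>2 powi e\<close> the spacing of floating-point numbers is a multiple of the spacing in the
  binade of \<open>2 powi e\<close>; the gap below \<open>2 powi e\<close> is finer, hence the assumption on \<open>\<bar>y\<bar>\<close>.\<close>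

lemma floats_multiple_ulp:
  assumes "y \<in> floats p" and "1 \<le> p" and "2 powi e \<le> \<bar>y\<bar>"
  shows "y / 2 powi (e - int p + 1) \<in> \<int>"
proof (cases "y = 0")
  case False
  with assms(1) obtain s :: nat and e' :: int and m :: real
    where y: "y = (-1) ^ s * 2 powi e' * m" and s: "s \<in> {0, 1}"
      and m: "1 \<le> m" "m < 2" "m * 2 ^ (p - 1) \<in> \<int>"
    unfolding floats_def by blast
  have abs_y: "\<bar>y\<bar> = 2 powi e' * m"
    using m by (simp add: y abs_mult power_abs)
  have "(2::real) powi e < 2 powi e' * 2"
  proof -
    have "2 powi e' * m < 2 powi e' * 2"
      using m(2) by (intro mult_strict_left_mono) simp_all
    then show ?thesis using assms(3) abs_y by linarith
  qed
  then have "(2::real) powi e < 2 powi (e' + 1)"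
    by (simp add: power_int_add)
  then have "e \<le> e'"
    using power_int_increasing[of "e' + 1" e "2::real"] by linarith
  then obtain d :: nat where d: "e' = e + int d"
    using zle_iff_zadd by blast
  have "y / 2 powi (e - int p + 1) = (-1) ^ s * 2 ^ d * (m * 2 ^ (p - 1))"
    using assms(2)
    by (simp add: y d power_int_add power_int_diff of_nat_diff power_diff field_simps)
  then show ?thesis
    using m(3) by (metis Ints_1 Ints_minus Ints_mult Ints_numeral Ints_power)
qed auto

text \<open>The upper bound \<open>\<bar>k\<bar> = 2 ^ p\<close> is the first number of the next binade; it has to be included
  since rounding away from zero can reach it.\<close>

lemma integer_multiple_ulp_in_floats:
  assumes "1 \<le> p" and "2 ^ (p - 1) \<le> \<bar>k\<bar>" and "\<bar>k\<bar> \<le> 2 ^ p"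
  shows "2 powi (e - int p + 1) * of_int k \<in> floats p"
proof -
  define s :: nat where "s = (if k < 0 then 1 else 0)"
  have s: "s \<in> {0, 1}" "1 * 2 ^ (p - 1) \<in> (\<int>::real set)" "1 \<le> (1::real)" "1 < (2::real)"
    by (simp_all add: s_def)
  have k: "real_of_int k = (-1) ^ s * of_int \<bar>k\<bar>" by (simp add: s_def)
  have lo: "2 ^ (p - 1) \<le> real_of_int \<bar>k\<bar>"
    using assms(2) by (metis of_int_le_iff of_int_numeral of_int_power)
  have pp: "(2::real) ^ p = 2 * 2 ^ (p - 1)"
    using assms(1) by (metis One_nat_def Suc_le_lessD power_minus_mult mult.commute)
  have scale: "(2::real) powi (e - int p + 1) = 2 powi e / 2 ^ (p - 1)"
    using pp by (simp add: power_int_add power_int_diff)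
  show ?thesis
  proof (cases "\<bar>k\<bar> = 2 ^ p")
    case True
    then have "real_of_int \<bar>k\<bar> = 2 ^ p" by simp
    then have "2 powi (e - int p + 1) * of_int k = (-1) ^ s * 2 powi (e + 1) * (1::real)"
      unfolding scale by (subst k) (simp add: pp power_int_add)
    then show ?thesis
      unfolding floats_def using s by blast
  next
    case False
    with assms(3) have "\<bar>k\<bar> < 2 ^ p" by simp
    then have "real_of_int \<bar>k\<bar> < 2 ^ p"
      by (metis of_int_less_iff of_int_numeral of_int_power)
    then have hi: "of_int \<bar>k\<bar> / 2 ^ (p - 1) < (2::real)"
      by (simp add: pp field_simps)
    have "2 powi (e - int p + 1) * of_int k = (-1) ^ s * 2 powi e * (of_int \<bar>k\<bar> / 2 ^ (p - 1) :: real)"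
      unfolding scale by (subst k) simp
    moreover have "1 \<le> real_of_int \<bar>k\<bar> / 2 ^ (p - 1)" using lo by simp
    moreover have "(of_int \<bar>k\<bar> / 2 ^ (p - 1)) * 2 ^ (p - 1) \<in> (\<int>::real set)" by simp
    ultimately show ?thesis
      unfolding floats_def using hi s(1) by blast
  qed
qed

lemma ulp_pos: "0 < ulp p x"
  by (simp add: ulp_def)

lemma exponent_bounds:
  assumes "x \<noteq> 0"
  shows "2 powi fp_exponent x \<le> \<bar>x\<bar>" and "\<bar>x\<bar> < 2 * 2 powi fp_exponent x"
  using fp_decomposition(2,3)[OF assms] by (simp_all add: fp_significand_def field_simps)

lemma two_powi_exponent_eq:
  assumes "1 \<le> q"
  shows "2 powi fp_exponent x = 2 ^ (q - 1) * ulp q x"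
  using assms by (simp add: ulp_def power_int_add power_int_diff power_diff)

lemma ulp_le:
  assumes "x \<noteq> 0"
  shows "ulp q x \<le> unit_roundoff q * \<bar>x\<bar>"
proof -
  have "ulp q x = unit_roundoff q * 2 powi fp_exponent x"
    by (simp add: ulp_def unit_roundoff_def power_int_add power_int_diff)
  then show ?thesis
    using exponent_bounds(1)[OF assms] by (simp add: unit_roundoff_def)
qed

lemma scaled_bounds:
  assumes "1 \<le> q" and "x \<noteq> 0"
  shows "2 ^ (q - 1) \<le> \<bar>x / ulp q x\<bar>" and "\<bar>x / ulp q x\<bar> < 2 ^ q"
proof -
  have pp: "(2::real) ^ q = 2 * 2 ^ (q - 1)"
    using assms(1) by (metis One_nat_def Suc_le_lessD power_minus_mult mult.commute)
  show "2 ^ (q - 1) \<le> \<bar>x / ulp q x\<bar>" "\<bar>x / ulp q x\<bar> < 2 ^ q"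
    using exponent_bounds[OF assms(2)] ulp_pos[of q x]
    unfolding two_powi_exponent_eq[OF assms(1)] pp by (simp_all add: abs_divide field_simps)
qed

text \<open>Measured in units of \<open>ulp p x\<close>, the floating-point neighbour below \<open>x\<close> is the integer floor.\<close>

lemma greatest_float_below:
  assumes "1 \<le> p" and "x \<noteq> 0"
  shows "ulp p x * of_int \<lfloor>x / ulp p x\<rfloor> \<in> floats p"
    and "ulp p x * of_int \<lfloor>x / ulp p x\<rfloor> \<le> x"
    and "\<And>y. y \<in> floats p \<Longrightarrow> y \<le> x \<Longrightarrow> y \<le> ulp p x * of_int \<lfloor>x / ulp p x\<rfloor>"
proof -
  let ?N = "x / ulp p x"
  note b = scaled_bounds[OF assms] and g = ulp_pos[of p x]
  show "ulp p x * of_int \<lfloor>?N\<rfloor> \<le> x"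
    using g by (metis of_int_floor_le mult.commute pos_le_divide_eq)
  have "2 ^ (p - 1) \<le> \<bar>\<lfloor>?N\<rfloor>\<bar> \<and> \<bar>\<lfloor>?N\<rfloor>\<bar> \<le> 2 ^ p"
  proof (cases "0 < ?N")
    case True
    then have "(2::real) ^ (p - 1) \<le> ?N" "?N < 2 ^ p" using b by linarith+
    then have "2 ^ (p - 1) \<le> \<lfloor>?N\<rfloor>" "\<lfloor>?N\<rfloor> < 2 ^ p"
      by (simp_all add: le_floor_iff floor_less_iff)
    then show ?thesis by (smt (verit) zero_less_power)
  next
    case False
    then have "?N \<le> - (2 ^ (p - 1))" "- (2 ^ p) < ?N" using b by linarith+
    then have "\<lfloor>?N\<rfloor> \<le> - (2 ^ (p - 1))" "- (2 ^ p) \<le> \<lfloor>?N\<rfloor>"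
      by (simp_all add: le_floor_iff floor_le_iff)
    then show ?thesis by (smt (verit) zero_less_power)
  qed
  then show "ulp p x * of_int \<lfloor>?N\<rfloor> \<in> floats p"
    using integer_multiple_ulp_in_floats[OF assms(1)] by (simp add: ulp_def)
  fix y assume y: "y \<in> floats p" "y \<le> x"
  show "y \<le> ulp p x * of_int \<lfloor>?N\<rfloor>"
  proof (cases "2 powi fp_exponent x \<le> \<bar>y\<bar>")
    case True
    then obtain k where k: "y / ulp p x = of_int k"
      using floats_multiple_ulp[of y p "fp_exponent x"] y assms(1)
      unfolding ulp_def by (auto elim: Ints_cases)
    then have "of_int k \<le> ?N" using y g by (metis divide_right_mono less_imp_le)
    then have "k \<le> \<lfloor>?N\<rfloor>" by (simp add: le_floor_iff)
    moreover have "y = ulp p x * of_int k" using k g by (simp add: field_simps)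
    ultimately show ?thesis using g by simp
  next
    \<comment> \<open>Here \<open>y\<close> need not be a multiple of \<open>ulp p x\<close>, but \<open>x\<close> is positive, and the rounded-down
      multiple of \<open>ulp p x\<close> is still at least \<open>2 powi fp_exponent x\<close>.\<close>
    case False
    have "0 < x"
      using False y exponent_bounds(1)[OF assms(2)] by linarith
    then have "0 < ?N" using g by simp
    then have "(2::real) ^ (p - 1) \<le> ?N" using b by linarith
    then have "2 ^ (p - 1) \<le> \<lfloor>?N\<rfloor>" by (simp add: le_floor_iff)
    then have "(2::real) ^ (p - 1) \<le> of_int \<lfloor>?N\<rfloor>"
      by (metis of_int_le_iff of_int_numeral of_int_power)
    then have "2 powi fp_exponent x \<le> ulp p x * of_int \<lfloor>?N\<rfloor>"
      unfolding two_powi_exponent_eq[OF assms(1)] using g by simp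
    with False show ?thesis by linarith
  qed
qed

lemma floats_uminus: "- y \<in> floats p \<longleftrightarrow> y \<in> floats p"
proof -
  have "- y \<in> floats p" if "y \<in> floats p" for y
  proof (cases "y = 0")
    case False
    with that obtain s :: nat and e :: int and m :: real
      where y: "y = (-1) ^ s * 2 powi e * m" and s: "s \<in> {0, 1}"
        and m: "1 \<le> m" "m < 2" "m * 2 ^ (p - 1) \<in> \<int>"
      unfolding floats_def by blast
    have "- y = (-1) ^ (1 - s) * 2 powi e * m" "1 - s \<in> {0, 1}"
      using y s by auto
    with m show ?thesis unfolding floats_def by blast
  qed (simp add: floats_def)
  from this[of y] this[of "- y"] show ?thesis by auto
qed

lemma fp_floor_eq:
  assumes "1 \<le> p" and "x \<noteq> 0"
  shows "fp_floor p x = ulp p x * of_int \<lfloor>x / ulp p x\<rfloor>"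
  unfolding fp_floor_def
  by (rule Greatest_equality) (use greatest_float_below[OF assms] in auto)

lemma ulp_uminus: "ulp p (- x) = ulp p x"
  by (simp add: ulp_def fp_exponent_def)

lemma fp_ceil_eq:
  assumes "1 \<le> p" and "x \<noteq> 0"
  shows "fp_ceil p x = ulp p x * of_int \<lceil>x / ulp p x\<rceil>"
proof -
  let ?z = "ulp p (- x) * of_int \<lfloor>- x / ulp p (- x)\<rfloor>"
  note g = greatest_float_below[of p "- x"]
  have "fp_ceil p x = - ?z"
    unfolding fp_ceil_def
  proof (rule Least_equality)
    show "- ?z \<in> floats p \<and> x \<le> - ?z"
      using g(1,2) assms by (simp add: floats_uminus le_minus_iff)
    show "- ?z \<le> y" if "y \<in> floats p \<and> x \<le> y" for y
      using g(3)[of "- y"] assms that by (simp add: floats_uminus minus_le_iff)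
  qed
  then show ?thesis
    by (simp add: ulp_uminus ceiling_def)
qed

section \<open>Truncation and the law of a single rounding\<close>

lemma fp_trunc_eq:
  assumes "1 \<le> q" and "x \<noteq> 0"
  shows "fp_trunc q x = sgn x * (ulp q x * of_int \<lfloor>\<bar>x\<bar> / ulp q x\<rfloor>)"
proof -
  have "fp_significand x * 2 ^ (q - 1) = \<bar>x\<bar> / ulp q x"
    using ulp_pos[of q x] by (simp add: fp_significand_def two_powi_exponent_eq[OF assms(1)])
  then show ?thesis
    using assms(2) by (simp add: fp_trunc_def two_powi_exponent_eq[OF assms(1)])
qed

lemma multiple_floor_bounds:
  fixes x g :: real
  assumes "0 < g"
  shows "g * of_int \<lfloor>x / g\<rfloor> \<le> x" and "x < g * of_int \<lfloor>x / g\<rfloor> + g"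
proof -
  have *: "of_int \<lfloor>x / g\<rfloor> \<le> x / g" "x / g < of_int \<lfloor>x / g\<rfloor> + 1" by linarith+
  show "g * of_int \<lfloor>x / g\<rfloor> \<le> x"
    using *(1) assms by (metis mult.commute pos_le_divide_eq)
  show "x < g * of_int \<lfloor>x / g\<rfloor> + g"
    using *(2) assms by (simp add: field_simps)
qed

lemma abs_fp_trunc_diff_le:
  assumes "1 \<le> q"
  shows "\<bar>fp_trunc q x - x\<bar> \<le> unit_roundoff q * \<bar>x\<bar>"
proof (cases "x = 0")
  case False
  have "\<bar>fp_trunc q x - x\<bar> \<le> ulp q x"
    using multiple_floor_bounds[OF ulp_pos[of q x], of "\<bar>x\<bar>"] False
    unfolding fp_trunc_eq[OF assms False]
    by (cases "0 < x") (simp_all add: abs_if)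
  then show ?thesis using ulp_le[OF False, of q] by linarith
qed (simp add: fp_trunc_def)

lemma floor_multiple_mono:
  fixes x h :: real
  assumes "0 < h" and "k * h \<le> x" and "k \<in> \<int>"
  shows "k * h \<le> h * of_int \<lfloor>x / h\<rfloor>"
proof -
  from assms(3) obtain i where i: "k = of_int i" by (auto elim: Ints_cases)
  then have "of_int i \<le> x / h" using assms by (simp add: field_simps)
  then have "i \<le> \<lfloor>x / h\<rfloor>" by (simp add: le_floor_iff)
  then show ?thesis using assms(1) by (simp add: i)
qed

text \<open>This is what makes \<open>sr_prob\<close> a probability. Truncation to \<open>p + r\<close> bits works on a grid that
  refines the \<open>p\<close>-bit grid, so it cannot pass the \<open>p\<close>-bit neighbour nearer to zero.\<close>

lemma fp_trunc_between:
  assumes "1 \<le> p" and "x \<noteq> 0"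
  shows "fp_floor p x \<le> fp_trunc (p + r) x" and "fp_trunc (p + r) x \<le> fp_ceil p x"
proof -
  let ?g = "ulp p x" and ?h = "ulp (p + r) x"
  have gh: "?g = 2 ^ r * ?h"
    by (simp add: ulp_def power_int_add power_int_diff)
  note g = ulp_pos[of p x] and h = ulp_pos[of "p + r" x]
  have coarse: "?g * of_int \<lfloor>\<bar>x\<bar> / ?g\<rfloor> \<le> ?h * of_int \<lfloor>\<bar>x\<bar> / ?h\<rfloor>"
  proof -
    have "(2 ^ r * of_int \<lfloor>\<bar>x\<bar> / ?g\<rfloor>) * ?h \<le> ?h * of_int \<lfloor>\<bar>x\<bar> / ?h\<rfloor>"
      using multiple_floor_bounds(1)[OF g, of "\<bar>x\<bar>"]
      by (intro floor_multiple_mono[OF h]) (simp_all add: gh mult_ac)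
    then show ?thesis by (simp add: gh mult_ac)
  qed
  have q: "1 \<le> p + r" using assms(1) by simp
  have fine: "?h * of_int \<lfloor>\<bar>x\<bar> / ?h\<rfloor> \<le> \<bar>x\<bar>"
    by (rule multiple_floor_bounds(1)[OF h])
  have le_ceil: "x \<le> ?g * of_int \<lceil>x / ?g\<rceil>"
    using multiple_floor_bounds(1)[OF g, of "- x"] by (simp add: ceiling_def)
  have floor_le: "?g * of_int \<lfloor>x / ?g\<rfloor> \<le> x"
    by (rule multiple_floor_bounds(1)[OF g])
  show "fp_floor p x \<le> fp_trunc (p + r) x" "fp_trunc (p + r) x \<le> fp_ceil p x"
    unfolding fp_floor_eq[OF assms] fp_ceil_eq[OF assms] fp_trunc_eq[OF q assms(2)]
    using coarse fine le_ceil floor_le assms(2)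
    by (cases "0 < x"; simp add: ceiling_def)+
qed

lemma fp_ceil_minus_floor_le:
  assumes "1 \<le> p" and "x \<noteq> 0"
  shows "fp_ceil p x - fp_floor p x \<le> ulp p x"
proof -
  have "\<lceil>x / ulp p x\<rceil> \<le> \<lfloor>x / ulp p x\<rfloor> + 1" by linarith
  then have "real_of_int \<lceil>x / ulp p x\<rceil> - of_int \<lfloor>x / ulp p x\<rfloor> \<le> 1" by linarith
  then show ?thesis
    unfolding fp_floor_eq[OF assms] fp_ceil_eq[OF assms] right_diff_distrib[symmetric]
    using ulp_pos[of p x] by (simp add: mult_left_le)
qed

lemma sr_prob_bounds:
  assumes "1 \<le> p" and "x \<noteq> 0"
  shows "0 \<le> sr_prob p r x" and "sr_prob p r x \<le> 1"
  using fp_trunc_between[OF assms, of r] fp_ceil_minus_floor_le[OF assms] ulp_pos[of p x]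
  by (simp_all add: sr_prob_def)

lemma set_pmf_SR_subset:
  assumes "x \<noteq> 0"
  shows "set_pmf (SR p r x) \<subseteq> {fp_ceil p x, fp_floor p x}"
  using assms by (auto simp: SR_def)

lemma finite_set_pmf_SR: "finite (set_pmf (SR p r x))"
  by (simp add: SR_def)

lemma abs_SR_minus_fp_trunc_le:
  assumes "1 \<le> p" and "t \<in> set_pmf (SR p r x)"
  shows "\<bar>t - fp_trunc (p + r) x\<bar> \<le> unit_roundoff p * \<bar>x\<bar>"
proof (cases "x = 0")
  case True
  with assms(2) show ?thesis by (simp add: SR_def fp_trunc_def)
next
  case False
  then have "t = fp_ceil p x \<or> t = fp_floor p x"
    using assms(2) set_pmf_SR_subset by blast
  then have "\<bar>t - fp_trunc (p + r) x\<bar> \<le> ulp p x"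
    using fp_trunc_between[OF assms(1) False, of r] fp_ceil_minus_floor_le[OF assms(1) False]
    by auto
  then show ?thesis using ulp_le[OF False, of p] by linarith
qed

text \<open>The mean is the truncation in both cases: for \<open>x\<close> not representable the two neighbours are
  \<open>ulp p x\<close> apart; otherwise both neighbours and the truncation are \<open>x\<close> itself.\<close>

lemma expectation_SR:
  assumes "1 \<le> p"
  shows "measure_pmf.expectation (SR p r x) (\<lambda>t. t) = fp_trunc (p + r) x"
proof (cases "x = 0")
  case True
  then show ?thesis by (simp add: SR_def fp_trunc_def)
next
  case False
  let ?N = "x / ulp p x"
  have "(fp_ceil p x - fp_floor p x) * sr_prob p r x = fp_trunc (p + r) x - fp_floor p x"
  proof (cases "?N \<in> \<int>")
    case True
    then have "fp_ceil p x = fp_floor p x"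
      by (auto elim!: Ints_cases simp: fp_ceil_eq[OF assms False] fp_floor_eq[OF assms False])
    then show ?thesis using fp_trunc_between[OF assms False, of r] by simp
  next
    case nonint: False
    then have "\<lceil>?N\<rceil> = \<lfloor>?N\<rfloor> + 1" by (simp add: ceiling_altdef Ints_def image_iff)
    then have "fp_ceil p x - fp_floor p x = ulp p x"
      by (simp add: fp_ceil_eq[OF assms False] fp_floor_eq[OF assms False] algebra_simps)
    then show ?thesis
      using ulp_pos[of p x] by (simp add: sr_prob_def)
  qed
  then show ?thesis
    using False sr_prob_bounds[OF assms False, of r]
    by (simp add: SR_def algebra_simps)
qed

section \<open>Noise and bias of a stochastic rounding\<close>

lemma expectation_bind_finite:
  fixes f :: "'b \<Rightarrow> real"
  assumes "finite (set_pmf M)" and "\<And>x. finite (set_pmf (N x))"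
  shows "measure_pmf.expectation (bind_pmf M N) f
    = measure_pmf.expectation M (\<lambda>x. measure_pmf.expectation (N x) f)"
  by (simp add: pmf_expectation_bind[OF assms(1,2) subset_refl] integral_measure_pmf[OF assms(1)])

text \<open>A random rounding \<open>R\<close> with mean \<open>\<mu>\<close>, relative fluctuation about the mean at most \<open>u\<close>, and
  relative bias at most \<open>v\<close>. At \<open>x = 0\<close> the bounds force \<open>R 0\<close> to be the point mass at \<open>0\<close>.\<close>

locale stochastic_rounding =
  fixes R :: "real \<Rightarrow> real pmf" and \<mu> :: "real \<Rightarrow> real" and u v :: real
  assumes finite_R: "finite (set_pmf (R x))"
    and expectation_R: "measure_pmf.expectation (R x) (\<lambda>t. t) = \<mu> x"
    and fluctuation_le: "t \<in> set_pmf (R x) \<Longrightarrow> \<bar>t - \<mu> x\<bar> \<le> u * \<bar>x\<bar>"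
    and bias_le: "\<bar>\<mu> x - x\<bar> \<le> v * \<bar>x\<bar>"
    and u_nonneg: "0 \<le> u" and v_nonneg: "0 \<le> v"
begin

text \<open>The zero-mean part \<open>\<alpha>\<close> of the relative error when \<open>x\<close> is rounded to \<open>t\<close>. Division by zero
  gives \<open>noise 0 t = 0\<close>, so that the bound by \<open>u\<close> holds there as well.\<close>

definition noise :: "real \<Rightarrow> real \<Rightarrow> real" where
  "noise x t = (t - \<mu> x) / x"

lemma noise_mult: "t \<in> set_pmf (R x) \<Longrightarrow> x * noise x t = t - \<mu> x"
  using fluctuation_le[of t x] by (cases "x = 0") (auto simp: noise_def)

lemma abs_noise_le:
  assumes "t \<in> set_pmf (R x)"
  shows "\<bar>noise x t\<bar> \<le> u"
proof (cases "x = 0")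
  case False
  then show ?thesis
    using fluctuation_le[OF assms] by (simp add: noise_def field_simps abs_divide)
qed (simp add: noise_def u_nonneg)

lemma integrable_R: "integrable (R x) (f :: real \<Rightarrow> real)"
  by (rule integrable_measure_pmf_finite[OF finite_R])

lemma expectation_noise: "measure_pmf.expectation (R x) (noise x) = 0"
proof -
  have "measure_pmf.expectation (R x) (\<lambda>t. (t - \<mu> x) / x) = 0"
    using expectation_R[of x] by (simp add: integrable_R)
  then show ?thesis by (simp add: noise_def[abs_def])
qed

lemma expectation_noise_sq: "measure_pmf.expectation (R x) (\<lambda>t. (noise x t)\<^sup>2) \<le> u\<^sup>2"
proof -
  have "measure_pmf.expectation (R x) (\<lambda>t. (noise x t)\<^sup>2) \<le> measure_pmf.expectation (R x) (\<lambda>t. u\<^sup>2)"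
    by (intro integral_mono_AE integrable_R AE_pmfI)
       (use abs_noise_le u_nonneg abs_le_square_iff in force)
  then show ?thesis by simp
qed

lemma expectation_times_noise:
  "measure_pmf.expectation (R x) (\<lambda>t. w * (1 + noise x t)) = w"
  by (simp add: integrable_R expectation_noise algebra_simps)

lemma expectation_times_noise_sq:
  "measure_pmf.expectation (R x) (\<lambda>t. (w * (1 + noise x t))\<^sup>2) \<le> (1 + u\<^sup>2) * w\<^sup>2"
proof -
  have "measure_pmf.expectation (R x) (\<lambda>t. (w * (1 + noise x t))\<^sup>2)
      = measure_pmf.expectation (R x) (\<lambda>t. w\<^sup>2 + 2 * w\<^sup>2 * noise x t + w\<^sup>2 * (noise x t)\<^sup>2)"
    by (simp add: algebra_simps power2_eq_square)
  also have "\<dots> = w\<^sup>2 + w\<^sup>2 * measure_pmf.expectation (R x) (\<lambda>t. (noise x t)\<^sup>2)"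
    by (simp add: integrable_R expectation_noise)
  also have "\<dots> \<le> w\<^sup>2 + w\<^sup>2 * u\<^sup>2"
    by (simp add: expectation_noise_sq mult_left_mono)
  finally show ?thesis by (simp add: algebra_simps)
qed

section \<open>The computed sum coupled with an unbiased martingale\<close>

text \<open>The joint law of \<open>(s\<^sub>k, z\<^sub>k)\<close>: the first component is the partial sum computed with \<open>R\<close> from
  the exact products \<open>c\<close>, the second is the sum that the same noises yield when every bias is
  dropped. Only the first component decides which arguments are rounded. As in \<open>sr_inner\<close>,
  the first product is not rounded a second time, and \<open>k = 0\<close> is a dummy case.\<close>

fun coupled :: "(nat \<Rightarrow> real) \<Rightarrow> nat \<Rightarrow> (real \<times> real) pmf" where
  "coupled c 0 = return_pmf (0, 0)"
| "coupled c (Suc 0) = map_pmf (\<lambda>t. (t, c 1 * (1 + noise (c 1) t))) (R (c 1))"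
| "coupled c (Suc (Suc k)) =
     bind_pmf (coupled c (Suc k)) (\<lambda>sz.
     bind_pmf (R (c (Suc (Suc k)))) (\<lambda>t.
     map_pmf (\<lambda>s'. (s', (snd sz + c (Suc (Suc k)) * (1 + noise (c (Suc (Suc k))) t))
                          * (1 + noise (fst sz + t) s')))
       (R (fst sz + t))))"

lemma finite_coupled: "finite (set_pmf (coupled c k))"
  by (induction c k rule: coupled.induct) (auto simp: finite_R)

lemma integrable_coupled: "integrable (coupled c k) (f :: _ \<Rightarrow> real)"
  by (rule integrable_measure_pmf_finite[OF finite_coupled])

lemma expectation_coupled_Suc:
  fixes f :: "real \<times> real \<Rightarrow> real"
  shows "measure_pmf.expectation (coupled c (Suc (Suc k))) f =
    measure_pmf.expectation (coupled c (Suc k)) (\<lambda>sz.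
    measure_pmf.expectation (R (c (Suc (Suc k)))) (\<lambda>t.
    measure_pmf.expectation (R (fst sz + t)) (\<lambda>s'.
      f (s', (snd sz + c (Suc (Suc k)) * (1 + noise (c (Suc (Suc k))) t))
               * (1 + noise (fst sz + t) s')))))"
  by (simp add: expectation_bind_finite finite_coupled finite_R)

lemma expectation_martingale:
  "measure_pmf.expectation (coupled c k) snd = (\<Sum>i=1..k. c i)"
proof (induction c k rule: coupled.induct)
  case (3 c k)
  have "measure_pmf.expectation (coupled c (Suc (Suc k))) snd
      = measure_pmf.expectation (coupled c (Suc k)) (\<lambda>sz.
          measure_pmf.expectation (R (c (Suc (Suc k)))) (\<lambda>t.
            snd sz + c (Suc (Suc k)) * (1 + noise (c (Suc (Suc k))) t)))"
    unfolding expectation_coupled_Suc snd_conv expectation_times_noise ..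
  also have "\<dots> = measure_pmf.expectation (coupled c (Suc k)) (\<lambda>sz. snd sz + c (Suc (Suc k)))"
    by (simp add: expectation_noise integrable_R del: coupled.simps)
  also have "\<dots> = measure_pmf.expectation (coupled c (Suc k)) snd + c (Suc (Suc k))"
    by (simp add: integrable_coupled del: coupled.simps)
  finally show ?case using 3 by simp
qed (simp_all add: expectation_noise integrable_R)

text \<open>With \<open>G = 1 + u\<^sup>2\<close>, one step takes the second moment \<open>M\<close> of \<open>z\<^sub>k\<close> to at most
  \<open>G (M + 2 d Y + G d\<^sup>2)\<close>, where \<open>d\<close> is the new product and \<open>Y\<close> the exact partial sum: the rounding
  of \<open>d\<close> is independent of \<open>z\<^sub>k\<close>, so the mixed term is \<open>2 d Y\<close> without error.\<close>

lemma second_moment_martingale: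
  assumes "1 \<le> k"
  shows "measure_pmf.expectation (coupled c k) (\<lambda>sz. (snd sz)\<^sup>2)
    \<le> (\<Sum>i=1..k. c i)\<^sup>2 + (\<Sum>i=1..k. \<bar>c i\<bar>)\<^sup>2 * gam k (u\<^sup>2)"
  using assms
proof (induction k rule: dec_induct)
  case base
  show ?case
    using expectation_times_noise_sq[of "c 1" "c 1"] by (simp add: gam_def algebra_simps)
next
  case (step k)
  then obtain j where k: "k = Suc j" by (cases k) auto
  define d where "d = c (Suc k)"
  define Y where "Y = (\<Sum>i=1..k. c i)"
  define S where "S = (\<Sum>i=1..k. \<bar>c i\<bar>)"
  define G where "G = 1 + u\<^sup>2"
  define M where "M = measure_pmf.expectation (coupled c k) (\<lambda>sz. (snd sz)\<^sup>2)"
  have S0: "0 \<le> S" by (simp add: S_def sum_nonneg)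
  have YS: "(Y + d)\<^sup>2 \<le> (S + \<bar>d\<bar>)\<^sup>2"
  proof -
    have "\<bar>Y\<bar> \<le> S" unfolding Y_def S_def by (rule sum_abs)
    then have "\<bar>Y + d\<bar> \<le> \<bar>S + \<bar>d\<bar>\<bar>" by linarith
    then show ?thesis by (simp add: abs_le_square_iff)
  qed
  have G1: "1 \<le> G" by (simp add: G_def)
  have inner: "measure_pmf.expectation (R d) (\<lambda>t.
      measure_pmf.expectation (R (fst sz + t)) (\<lambda>s'.
        ((snd sz + d * (1 + noise d t)) * (1 + noise (fst sz + t) s'))\<^sup>2))
    \<le> G * ((snd sz)\<^sup>2 + 2 * d * snd sz + G * d\<^sup>2)" for sz :: "real \<times> real"
  proof -
    have "measure_pmf.expectation (R d) (\<lambda>t.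
        measure_pmf.expectation (R (fst sz + t)) (\<lambda>s'.
          ((snd sz + d * (1 + noise d t)) * (1 + noise (fst sz + t) s'))\<^sup>2))
      \<le> measure_pmf.expectation (R d) (\<lambda>t. G * (snd sz + d * (1 + noise d t))\<^sup>2)"
      unfolding G_def by (intro integral_mono integrable_R expectation_times_noise_sq)
    also have "\<dots> = G * measure_pmf.expectation (R d) (\<lambda>t.
        (snd sz)\<^sup>2 + 2 * snd sz * (d * (1 + noise d t)) + (d * (1 + noise d t))\<^sup>2)"
      by (simp add: power2_sum add_ac mult_ac)
    also have "\<dots> = G * ((snd sz)\<^sup>2 + 2 * snd sz * d
        + measure_pmf.expectation (R d) (\<lambda>t. (d * (1 + noise d t))\<^sup>2))"
      using expectation_times_noise[of d d] by (simp add: integrable_R)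
    also have "\<dots> \<le> G * ((snd sz)\<^sup>2 + 2 * snd sz * d + G * d\<^sup>2)"
      using expectation_times_noise_sq[of d d] G1
      by (intro mult_left_mono add_left_mono) (simp_all add: G_def)
    finally show ?thesis by (simp add: mult_ac)
  qed
  have "measure_pmf.expectation (coupled c (Suc k)) (\<lambda>sz. (snd sz)\<^sup>2)
      \<le> measure_pmf.expectation (coupled c k) (\<lambda>sz. G * ((snd sz)\<^sup>2 + 2 * d * snd sz + G * d\<^sup>2))"
    unfolding k expectation_coupled_Suc snd_conv
    using inner unfolding d_def k by (intro integral_mono integrable_coupled)
  also have "\<dots> = G * (M + 2 * d * Y + G * d\<^sup>2)"
    using expectation_martingale[of c k] by (simp add: integrable_coupled M_def Y_def)
  also have "\<dots> \<le> G * (Y\<^sup>2 + S\<^sup>2 * (G ^ k - 1) + 2 * d * Y + G * d\<^sup>2)"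
    using step.IH G1 by (intro mult_left_mono) (simp_all add: M_def Y_def S_def G_def gam_def)
  also have "\<dots> = (Y + d)\<^sup>2 + ((G - 1) * (Y + d)\<^sup>2 + S\<^sup>2 * (G ^ Suc k - G) + d\<^sup>2 * (G\<^sup>2 - G))"
    by (simp add: algebra_simps power2_eq_square)
  also have "\<dots> \<le> (Y + d)\<^sup>2 + ((G - 1) * (S + \<bar>d\<bar>)\<^sup>2 + (S + \<bar>d\<bar>)\<^sup>2 * (G ^ Suc k - G))"
  proof -
    have "(G - 1) * (Y + d)\<^sup>2 \<le> (G - 1) * (S + \<bar>d\<bar>)\<^sup>2"
      using YS G1 by (simp add: mult_left_mono)
    moreover have "d\<^sup>2 * (G\<^sup>2 - G) \<le> d\<^sup>2 * (G ^ Suc k - G)"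
      using power_increasing[of 2 "Suc k" G] G1 step.hyps by (intro mult_left_mono) simp_all
    \<comment> \<open>Dropping the mixed term \<open>2 S \<bar>d\<bar>\<close> leaves room for the squares of \<open>S\<close> and \<open>d\<close> separately.\<close>
    moreover have "(S\<^sup>2 + d\<^sup>2) * (G ^ Suc k - G) \<le> (S + \<bar>d\<bar>)\<^sup>2 * (G ^ Suc k - G)"
      using power_increasing[of 1 "Suc k" G] G1 S0
      by (intro mult_right_mono) (simp_all add: power2_sum)
    ultimately show ?thesis by (simp add: algebra_simps)
  qed
  also have "\<dots> = (Y + d)\<^sup>2 + (S + \<bar>d\<bar>)\<^sup>2 * (G ^ Suc k - 1)"
    by (simp add: algebra_simps)
  finally show ?case
    by (simp add: Y_def S_def G_def d_def gam_def)
qed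

text \<open>Pathwise bounds. The recursion for the difference \<open>s\<^sub>k - z\<^sub>k\<close> feeds the bias with \<open>\<bar>s\<^sub>k\<bar>\<close>, so the
  size of \<open>s\<^sub>k\<close> is bounded in the same induction.\<close>

lemma coupled_bounds:
  assumes "1 \<le> k" and "sz \<in> set_pmf (coupled c k)"
  shows "\<bar>fst sz\<bar> \<le> (\<Sum>i=1..k. \<bar>c i\<bar>) * (1 + u + v) ^ k
    \<and> \<bar>fst sz - snd sz\<bar> \<le> (\<Sum>i=1..k. \<bar>c i\<bar>) * (gam k (u + v) - gam k u)"
  using assms
proof (induction k arbitrary: sz rule: dec_induct)
  case base
  then obtain t where t: "t \<in> set_pmf (R (c 1))" and sz: "sz = (t, c 1 * (1 + noise (c 1) t))"
    by auto
  show ?case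
    using noise_mult[OF t] fluctuation_le[OF t] bias_le[of "c 1"]
    by (simp add: sz gam_def algebra_simps abs_if split: if_splits)
next
  case (step k)
  then obtain j where k: "k = Suc j" by (cases k) auto
  define d where "d = c (Suc k)"
  define S where "S = (\<Sum>i=1..k. \<bar>c i\<bar>)"
  define A where "A = 1 + u + v"
  define B where "B = 1 + u"
  have S0: "0 \<le> S" by (simp add: S_def sum_nonneg)
  have AB: "1 \<le> B" "B \<le> A" using u_nonneg v_nonneg by (simp_all add: A_def B_def)
  from step.prems obtain s z t s' where sz: "(s, z) \<in> set_pmf (coupled c k)"
      and t: "t \<in> set_pmf (R d)" and s': "s' \<in> set_pmf (R (s + t))"
      and eq: "sz = (s', (z + d * (1 + noise d t)) * (1 + noise (s + t) s'))"
    by (auto simp: k d_def)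
  have s: "\<bar>s\<bar> \<le> S * A ^ k" and s_z: "\<bar>s - z\<bar> \<le> S * (A ^ k - B ^ k)"
    using step.IH[OF sz] by (simp_all add: S_def A_def B_def gam_def add_ac)
  define \<tau> where "\<tau> = d * (1 + noise d t)"
  define \<alpha> where "\<alpha> = noise (s + t) s'"
  have t_\<tau>: "\<bar>t - \<tau>\<bar> \<le> \<bar>d\<bar> * (A - B)"
    using noise_mult[OF t] bias_le[of d] by (simp add: \<tau>_def A_def B_def algebra_simps)
  have t_le: "\<bar>t\<bar> \<le> \<bar>d\<bar> * A"
    using fluctuation_le[OF t] bias_le[of d] by (simp add: A_def algebra_simps)
  have \<alpha>: "\<bar>1 + \<alpha>\<bar> \<le> B"
    using abs_noise_le[OF s'] by (simp add: \<alpha>_def B_def)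
  have \<beta>: "\<bar>\<mu> (s + t) - (s + t)\<bar> \<le> (A - B) * \<bar>s + t\<bar>"
    using bias_le[of "s + t"] by (simp add: A_def B_def)
  have s'_eq: "s' = (s + t) * (1 + \<alpha>) + (\<mu> (s + t) - (s + t))"
    using noise_mult[OF s'] by (simp add: \<alpha>_def algebra_simps)
  have pow: "A \<le> A ^ k" "A * A \<le> A ^ Suc k"
    using power_increasing[of 1 k A] power_increasing[of 2 "Suc k" A] AB step.hyps
    by (simp_all add: power2_eq_square)
  have st: "\<bar>s + t\<bar> \<le> (S + \<bar>d\<bar>) * A ^ k"
  proof -
    have "\<bar>d\<bar> * A \<le> \<bar>d\<bar> * A ^ k" using pow by (simp add: mult_left_mono)
    then show ?thesis using s t_le by (simp add: algebra_simps)
  qed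
  have "\<bar>s'\<bar> \<le> \<bar>s + t\<bar> * B + (A - B) * \<bar>s + t\<bar>"
  proof -
    have "\<bar>(s + t) * (1 + \<alpha>)\<bar> \<le> \<bar>s + t\<bar> * B"
      using \<alpha> by (simp add: abs_mult mult_left_mono)
    then show ?thesis using \<beta> unfolding s'_eq by linarith
  qed
  also have "\<dots> = \<bar>s + t\<bar> * A" by (simp add: algebra_simps)
  also have "\<dots> \<le> (S + \<bar>d\<bar>) * A ^ k * A" using st AB by (intro mult_right_mono) auto
  finally have 1: "\<bar>s'\<bar> \<le> (S + \<bar>d\<bar>) * A ^ Suc k" by (simp add: mult_ac)
  have diff: "s' - (z + \<tau>) * (1 + \<alpha>)
      = (s - z + (t - \<tau>)) * (1 + \<alpha>) + (\<mu> (s + t) - (s + t))"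
    by (subst s'_eq) (simp add: algebra_simps)
  have st_A: "\<bar>s + t\<bar> \<le> S * A ^ k + \<bar>d\<bar> * A" using s t_le by linarith
  have "\<bar>(s - z + (t - \<tau>)) * (1 + \<alpha>)\<bar> \<le> (S * (A ^ k - B ^ k) + \<bar>d\<bar> * (A - B)) * B"
    unfolding abs_mult using s_z t_\<tau> \<alpha> by (intro mult_mono) auto
  moreover have "(A - B) * \<bar>s + t\<bar> \<le> (A - B) * (S * A ^ k + \<bar>d\<bar> * A)"
    using st_A AB by (simp add: mult_left_mono)
  ultimately have "\<bar>s' - (z + \<tau>) * (1 + \<alpha>)\<bar>
      \<le> (S * (A ^ k - B ^ k) + \<bar>d\<bar> * (A - B)) * B + (A - B) * (S * A ^ k + \<bar>d\<bar> * A)"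
    using \<beta> unfolding diff by linarith
  also have "\<dots> = S * (A ^ Suc k - B ^ Suc k) + \<bar>d\<bar> * (A\<^sup>2 - B\<^sup>2)"
    by (simp add: algebra_simps power2_eq_square)
  also have "\<dots> \<le> S * (A ^ Suc k - B ^ Suc k) + \<bar>d\<bar> * (A ^ Suc k - B ^ Suc k)"
  proof -
    \<comment> \<open>The new product has gone through two roundings only; \<open>A ^ m - B ^ m\<close> increases with \<open>m\<close>
      because \<open>1 \<le> B \<le> A\<close>.\<close>
    have "A\<^sup>2 - B\<^sup>2 \<le> A ^ Suc k - B ^ Suc k"
      using step.hyps(1)
    proof (induction k rule: dec_induct)
      case base
      show ?case by (simp add: power2_eq_square)
    next
      case (step m)
      have "B ^ Suc m \<le> A ^ Suc m" using AB by (intro power_mono) auto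
      then have "B ^ Suc m * (B - 1) \<le> A ^ Suc m * (A - 1)"
        using AB by (intro mult_mono) auto
      with step.IH show ?case by (simp add: algebra_simps)
    qed
    then show ?thesis by (simp add: mult_left_mono)
  qed
  finally have 2: "\<bar>s' - (z + \<tau>) * (1 + \<alpha>)\<bar> \<le> (S + \<bar>d\<bar>) * (A ^ Suc k - B ^ Suc k)"
    by (simp add: algebra_simps)
  show ?case
    using 1 2 by (simp add: eq \<tau>_def \<alpha>_def S_def d_def A_def B_def gam_def add_ac)
qed

lemma coupled_error_bound:
  assumes "1 \<le> n" and "0 < lam" and "0 < u" and "0 < (\<Sum>i=1..n. \<bar>c i\<bar>)"
  shows "1 - lam \<le> measure_pmf.prob (map_pmf fst (coupled c n))
    {s. \<bar>s - (\<Sum>i=1..n. c i)\<bar> \<le> (\<Sum>i=1..n. \<bar>c i\<bar>) *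
       (sqrt (gam n (u\<^sup>2) / lam) + gam n (u + v) - gam n u)}"
proof -
  let ?P = "coupled c n"
  define Y where "Y = (\<Sum>i=1..n. c i)"
  define S where "S = (\<Sum>i=1..n. \<bar>c i\<bar>)"
  define \<epsilon> where "\<epsilon> = S * sqrt (gam n (u\<^sup>2) / lam)"
  have gam_pos: "0 < gam n (u\<^sup>2)"
    using assms(1,3) by (simp add: gam_def one_less_power)
  then have \<epsilon>: "0 < \<epsilon>" "\<epsilon>\<^sup>2 = S\<^sup>2 * gam n (u\<^sup>2) / lam"
    using assms(2,4) by (simp_all add: \<epsilon>_def S_def power_mult_distrib)
  have "measure_pmf.variance ?P snd = measure_pmf.expectation ?P (\<lambda>sz. (snd sz)\<^sup>2) - Y\<^sup>2"
    unfolding Y_def expectation_martingale[of c n, symmetric]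
    by (rule measure_pmf.variance_eq) (rule integrable_coupled)+
  then have var: "measure_pmf.variance ?P snd \<le> S\<^sup>2 * gam n (u\<^sup>2)"
    using second_moment_martingale[OF assms(1), of c]
    by (simp add: S_def Y_def)
  have "measure_pmf.prob ?P {sz. \<epsilon> \<le> \<bar>snd sz - Y\<bar>} \<le> measure_pmf.variance ?P snd / \<epsilon>\<^sup>2"
    using measure_pmf.Chebyshev_inequality[of snd ?P \<epsilon>] \<epsilon>(1)
    by (simp add: integrable_coupled expectation_martingale Y_def)
  also have "\<dots> \<le> S\<^sup>2 * gam n (u\<^sup>2) / \<epsilon>\<^sup>2"
    using var by (simp add: divide_right_mono)
  also have "\<dots> = lam"
    using \<epsilon> gam_pos assms(2,4) by (simp add: S_def)
  finally have "1 - lam \<le> 1 - measure_pmf.prob ?P {sz. \<epsilon> \<le> \<bar>snd sz - Y\<bar>}" by simp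
  also have "\<dots> = measure_pmf.prob ?P (- {sz. \<epsilon> \<le> \<bar>snd sz - Y\<bar>})"
    using measure_pmf.prob_compl[of "{sz. \<epsilon> \<le> \<bar>snd sz - Y\<bar>}" ?P] by (simp add: Compl_eq_Diff_UNIV)
  also have "\<dots> \<le> measure_pmf.prob ?P (fst -` {s. \<bar>s - Y\<bar> \<le> S *
       (sqrt (gam n (u\<^sup>2) / lam) + gam n (u + v) - gam n u)})"
  proof (rule measure_pmf.finite_measure_mono_AE)
    show "AE sz in ?P. sz \<in> - {sz. \<epsilon> \<le> \<bar>snd sz - Y\<bar>} \<longrightarrow> sz \<in> fst -` {s. \<bar>s - Y\<bar> \<le> S *
       (sqrt (gam n (u\<^sup>2) / lam) + gam n (u + v) - gam n u)}"
    proof (intro AE_pmfI impI)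
      fix sz assume "sz \<in> set_pmf ?P" and "sz \<in> - {sz. \<epsilon> \<le> \<bar>snd sz - Y\<bar>}"
      then have "\<bar>fst sz - snd sz\<bar> \<le> S * (gam n (u + v) - gam n u)" "\<bar>snd sz - Y\<bar> < \<epsilon>"
        using coupled_bounds[OF assms(1)] by (auto simp: S_def)
      then show "sz \<in> fst -` {s. \<bar>s - Y\<bar> \<le> S *
         (sqrt (gam n (u\<^sup>2) / lam) + gam n (u + v) - gam n u)}"
        by (simp add: \<epsilon>_def algebra_simps)
    qed
  qed simp
  finally show ?thesis by (simp add: S_def Y_def)
qed

end

section \<open>Limited-precision stochastic rounding\<close>

lemma stochastic_rounding_SR:
  assumes "1 \<le> p"
  shows "stochastic_rounding (SR p r) (fp_trunc (p + r)) (unit_roundoff p) (unit_roundoff (p + r))"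
proof unfold_locales
  show "\<bar>fp_trunc (p + r) x - x\<bar> \<le> unit_roundoff (p + r) * \<bar>x\<bar>" for x
    using assms by (intro abs_fp_trunc_diff_le) simp
  show "0 \<le> unit_roundoff p" "0 \<le> unit_roundoff (p + r)"
    by (simp_all add: unit_roundoff_def)
qed (use assms in \<open>simp_all add: finite_set_pmf_SR expectation_SR abs_SR_minus_fp_trunc_le\<close>)

lemma sr_inner_eq_map_fst:
  assumes "1 \<le> p"
  shows "sr_inner p r a b k
    = map_pmf fst (stochastic_rounding.coupled (SR p r) (fp_trunc (p + r)) (hadamard a b) k)"
proof -
  interpret stochastic_rounding "SR p r" "fp_trunc (p + r)" "unit_roundoff p" "unit_roundoff (p + r)"
    by (rule stochastic_rounding_SR[OF assms])
  show ?thesis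
  proof (induction k rule: induct_nat_012)
    case (ge2 k)
    then show ?case
      by (simp add: map_bind_pmf bind_map_pmf map_pmf_comp hadamard_def)
  qed (simp_all add: map_pmf_comp hadamard_def)
qed

theorem theorem7:
  fixes p r n :: nat and a b :: "nat \<Rightarrow> real" and y lam :: real
  assumes "1 \<le> p" and "1 \<le> r" and "1 \<le> n"
    and "y = (\<Sum>i=1..n. a i * b i)" and "y \<noteq> 0"
    and "0 < lam" and "lam < 1"
  shows "measure_pmf.prob (sr_inner p r a b n)
      {yhat. \<bar>yhat - y\<bar> / \<bar>y\<bar> \<le> cond_num n (hadamard a b) *
         (sqrt (gam n ((unit_roundoff p)\<^sup>2) / lam)
           + gam n (unit_roundoff p + unit_roundoff (p + r)) - gam n (unit_roundoff p))}
    \<ge> 1 - lam"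
proof -
  interpret stochastic_rounding "SR p r" "fp_trunc (p + r)" "unit_roundoff p" "unit_roundoff (p + r)"
    by (rule stochastic_rounding_SR[OF assms(1)])
  let ?c = "hadamard a b"
  have y: "y = (\<Sum>i=1..n. ?c i)" using assms(4) by (simp add: hadamard_def)
  have "0 < \<bar>y\<bar>" using assms(5) by simp
  also have "\<bar>y\<bar> \<le> (\<Sum>i=1..n. \<bar>?c i\<bar>)" unfolding y by (rule sum_abs)
  finally have S: "0 < (\<Sum>i=1..n. \<bar>?c i\<bar>)" .
  have u: "0 < unit_roundoff p" by (simp add: unit_roundoff_def)
  have "(e / \<bar>y\<bar> \<le> cond_num n ?c * B) = (e \<le> (\<Sum>i=1..n. \<bar>?c i\<bar>) * B)" for e B
    unfolding cond_num_def y[symmetric] using assms(5) by (simp add: divide_le_cancel)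
  then show ?thesis
    using coupled_error_bound[OF assms(3,6) u S] unfolding y[symmetric]
    by (simp only: sr_inner_eq_map_fst[OF assms(1)])
qed

end
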